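(* Let $a,b,c,d$ be positive real numbers with $\min\{c,d\}>\max\{a,b\}$, and let $\{P_n(x)\}_{n\in\mathbb{N}}$, $P_n(x):=P_n(x;a,b;c,d)$, be the monic $2$-orthogonal polynomial sequence with respect to the weight vector $\overline{\mathcal{W}}(x;a,b;c,d)$. Then, for all $n\in\mathbb{N}$, $$P_n(x)=\frac{(-1)^n(a)_n(b)_n}{\left(c+\left\lfloor\frac n2\right\rfloor\right)_n\left(d+\left\lfloor\frac{n-1}2\right\rfloor\right)_n}\;{}_3F_2\!\left(\begin{matrix}-n,\ c+\left\lfloor\frac n2\right\rfloor,\ d+\left\lfloor\frac{n-1}2\right\rfloor\\ a,\ b\end{matrix};x\right).$$
   Context: $\mathbb{N}=\{0,1,2,\dots\}$; $(z)_0=1$ and $(z)_n=z(z+1)\cdots(z+n-1)$. The series ${}_pF_q(\alpha_1,\dots,\alpha_p;\beta_1,\dots,\beta_q;z)=\sum_{j\ge0}\frac{(\alpha_1)_j\cdots(\alpha_p)_j}{(\beta_1)_j\cdots(\beta_q)_j}\frac{z^j}{j!}$; it is a polynomial when some $\alpha_i$ is a non-positive integer. For positive reals $a,b,c,d$ with $\delta:=c+d-a-b>0$, the function $\mathcal{W}(\cdot\,;a,b;c,d)$ on $(0,1)$ is $$\mathcal{W}(x;a,b;c,d)=\frac{\Gamma(c)\Gamma(d)}{\Gamma(a)\Gamma(b)\Gamma(\delta)}\,x^{a-1}(1-x)^{\delta-1}\,{}_2F_1(c-b,d-b;\delta;1-x).$$ (The condition $\min\{c,d\}>\max\{a,b\}$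 implies $\delta>0$.) The weight vector $\overline{\mathcal{W}}(x;a,b;c,d)$ has components $w_0(x)=\mathcal{W}(x;a,b;c,d)$ and $w_1(x)=\mathcal{W}(x;a,b+1;c+1,d)$. A sequence of monic polynomials $\{P_n\}_{n\in\mathbb{N}}$ with $\deg P_n=n$ is the monic $2$-orthogonal polynomial sequence with respect to $\overline{\mathcal{W}}(x;a,b;c,d)$ if, for each $j\in\{0,1\}$ and $k,n\in\mathbb{N}$, $\int_0^1x^kP_n(x)w_j(x)\,\mathrm{d}x$ equals $0$ if $n\ge 2k+j+1$ and is nonzero if $n=2k+j$. *)

theory Defs
  imports "HOL-Analysis.Analysis"
begin

text \<open>
  The series \<open>pFq(as; bs; z)\<close>, the parameters being given as lists. The sum is a \<open>suminf\<close>; it is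
  used below only where the series converges (a terminating \<open>3F2\<close>, and a \<open>2F1\<close> with
  positive lower parameter at an argument in \<open>(0,1)\<close>).
\<close>

definition hypergeo :: "real list \<Rightarrow> real list \<Rightarrow> real \<Rightarrow> real" where
  "hypergeo as bs z =
     (\<Sum>j. (\<Prod>\<alpha>\<leftarrow>as. pochhammer \<alpha> j) / (\<Prod>\<beta>\<leftarrow>bs. pochhammer \<beta> j) * (z ^ j / fact j))"

definition W :: "real \<Rightarrow> real \<Rightarrow> real \<Rightarrow> real \<Rightarrow> real \<Rightarrow> real" where
  "W a b c d x =
     (let \<delta> = c + d - a - b in
        Gamma c * Gamma d / (Gamma a * Gamma b * Gamma \<delta>)
          * x powr (a - 1) * (1 - x) powr (\<delta> - 1) * hypergeo [c - b, d - b] [\<delta>] (1 - x))"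

definition W_vec :: "real \<Rightarrow> real \<Rightarrow> real \<Rightarrow> real \<Rightarrow> nat \<Rightarrow> real \<Rightarrow> real" where
  "W_vec a b c d j = (if j = 0 then W a b c d else W a (b + 1) (c + 1) d)"

text \<open>
  Only the components \<open>w 0\<close> and \<open>w 1\<close> of the weight vector are relevant. Integrability is not
  demanded separately: for the weights \<open>W_vec\<close> with \<open>a, b, c, d > 0\<close> and
  \<open>min c d > max a b\<close> all the integrals converge absolutely.
\<close>

definition monic_2_orthogonal :: "(nat \<Rightarrow> real \<Rightarrow> real) \<Rightarrow> (nat \<Rightarrow> real poly) \<Rightarrow> bool" where
  "monic_2_orthogonal w P \<longleftrightarrow>
     (\<forall>n. degree (P n) = n \<and> lead_coeff (P n) = 1) \<and>
     (\<forall>j\<in>{0, 1}. \<forall>k n.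
        (n \<ge> 2 * k + j + 1 \<longrightarrow> (LBINT x:{0<..<1}. x ^ k * poly (P n) x * w j x) = 0) \<and>
        (n = 2 * k + j \<longrightarrow> (LBINT x:{0<..<1}. x ^ k * poly (P n) x * w j x) \<noteq> 0))"

end

theory Submission
  imports
    Defs
    "HOL-Real_Asymp.Real_Asymp"
begin

text \<open>
  Integrating the series of \<open>W\<close> termwise against \<open>x ^ k\<close> gives Beta integrals, so the \<open>k\<close>-th moment
  is, up to Gamma factors, the value \<open>2F1(c - b, d - b; c + d - b + k; 1)\<close>. The contiguous relation
  behind Gauss's summation theorem then yields the moment ratios
  \<open>(a + k) (b + k) / ((c + k) (d + k))\<close>; ratios suffice because the orthogonality conditions are
  homogeneous in each weight. With these moments, integrating the terminating \<open>3F2\<close> against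
  \<open>x ^ k w j\<close> gives an alternating binomial sum \<open>\<Sum>i\<le>n. (-1) ^ i (n choose i) q(i)\<close> with
  \<open>deg q = n - 1\<close>, which is an \<open>n\<close>-th difference and hence \<open>0\<close>. Uniqueness follows by triangularity:
  the functionals \<open>p \<mapsto> \<integral> x ^ k p w j\<close>, ordered by \<open>2 k + j\<close>, form an upper triangular system with
  nonzero diagonal on the polynomials \<open>P n\<close>.
\<close>

section \<open>Finite differences and the vanishing of the \<open>3F2\<close> moment sum\<close>

text \<open>Pascal's rule rewrites the sum of order \<open>n + 1\<close> for \<open>q(i)\<close> as
  the sum of order \<open>n\<close> for \<open>q(i) - q(i + 1)\<close>, which has smaller degree, so
  induction on \<open>n\<close> applies.\<close>

lemma alternating_binomial_sum_poly_eq_0: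
  fixes q :: "real poly"
  assumes "q = 0 \<or> degree q < n"
  shows "(\<Sum>i\<le>n. (-1) ^ i * of_nat (n choose i) * poly q (of_nat i)) = 0"
  using assms
proof (induction n arbitrary: q)
  case 0
  then show ?case by simp
next
  case (Suc n)
  define r where "r = q - pcompose q [:1, 1:]"
  define f where "f i = poly q (real i)" for i
  have r: "poly r (real i) = f i - f (Suc i)" for i
    by (simp add: r_def f_def poly_pcompose add.commute)
  \<comment> \<open>The leading coefficients of \<open>q\<close> and of its shift cancel. Constants
    are treated apart, since there the difference is 0 and no strict drop in degree is
    possible.\<close>
  have "r = 0 \<or> degree r < n"
  proof (cases "degree q = 0")
    case True
    then obtain c where "q = [:c:]" by (rule degree_eq_zeroE)
    then show ?thesis by (simp add: r_def)
  next
    case False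
    have *: "degree (pcompose q [:1, 1:]) = degree q" by (simp add: degree_pcompose)
    have "coeff (pcompose q [:1, 1:]) (degree q) = coeff q (degree q)"
      using lead_coeff_comp[of "[:1, 1:]" q] * by simp
    then have "coeff r (degree q) = 0" by (simp add: r_def)
    moreover have "degree r \<le> degree q"
      unfolding r_def using * by (intro degree_diff_le) auto
    ultimately have "degree r < degree q"
      using False by (metis eq_zero_or_degree_less degree_0 neq0_conv)
    then show ?thesis using Suc.prems False by auto
  qed
  then have "(\<Sum>i\<le>n. (-1) ^ i * real (n choose i) * (f i - f (Suc i))) = 0"
    using Suc.IH[of r] by (simp add: r)
  moreover have "(\<Sum>i\<le>Suc n. (-1) ^ i * real (Suc n choose i) * f i)
      = (\<Sum>i\<le>n. (-1) ^ i * real (n choose i) * (f i - f (Suc i)))"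
  proof -
    \<comment> \<open>The range is extended by the zero term with \<open>n choose Suc n\<close>, so
      that splitting off \<open>i = 0\<close> leaves a sum over the same range
      \<open>i \<le> n\<close>.\<close>
    have "(\<Sum>i\<le>n. (-1) ^ i * real (n choose i) * f i)
        = (\<Sum>i\<le>Suc n. (-1) ^ i * real (n choose i) * f i)"
      by simp
    also have "\<dots> = f 0 - (\<Sum>i\<le>n. (-1) ^ i * real (n choose Suc i) * f (Suc i))"
      by (subst sum.atMost_Suc_shift) (simp add: sum_negf)
    finally have 1: "(\<Sum>i\<le>n. (-1) ^ i * real (n choose i) * f i) = \<dots>" .
    have "(\<Sum>i\<le>Suc n. (-1) ^ i * real (Suc n choose i) * f i)
        = f 0 - (\<Sum>i\<le>n. (-1) ^ i * real (Suc n choose Suc i) * f (Suc i))"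
      by (subst sum.atMost_Suc_shift) (simp add: sum_negf)
    also have "\<dots> = f 0 - (\<Sum>i\<le>n. (-1) ^ i * real (n choose Suc i) * f (Suc i))
        - (\<Sum>i\<le>n. (-1) ^ i * real (n choose i) * f (Suc i))"
      by (simp add: algebra_simps sum.distrib)
    also have "\<dots> = (\<Sum>i\<le>n. (-1) ^ i * real (n choose i) * (f i - f (Suc i)))"
      by (simp add: 1[symmetric] right_diff_distrib sum_subtractf)
    finally show ?thesis .
  qed
  ultimately show ?case by (simp add: f_def)
qed

lemma pochhammer_shift_poly:
  obtains q :: "real poly" where "degree q \<le> n" "\<And>x. poly q x = pochhammer (z + x) n"
proof
  let ?q = "\<Prod>i<n. [:z + real i, 1:]"
  show "degree ?q \<le> n"
    using degree_prod_sum_le[of "{..<n}" "\<lambda>i. [:z + real i, 1:]"] by simp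
  show "poly ?q x = pochhammer (z + x) n" for x
    by (simp add: poly_prod pochhammer_prod atLeast0LessThan algebra_simps)
qed

text \<open>Pair \<open>(a)_(k+i)\<close> with \<open>(a)_i\<close>, \<open>(b+j)_(k+i)\<close> with
  \<open>(b)_i\<close>, \<open>(c+m)_i\<close> with \<open>(c+j)_(k+i)\<close> and
  \<open>(d+p)_i\<close> with \<open>(d)_(k+i)\<close>. Up to constants the quotients are
  polynomials in \<open>i\<close> of degrees at most \<open>k\<close>, \<open>k+j\<close>,
  \<open>m-j-k\<close> and \<open>p-k\<close>, which add up to \<open>m+p = n-1\<close>; and
  \<open>(-n)_i / i!\<close> is a signed binomial coefficient.\<close>

lemma hypergeometric_moment_sum_eq_0:
  fixes a b c d :: real
  assumes pos: "a > 0" "b > 0" "c > 0" "d > 0"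
    and n: "n = Suc (m + p)" and k: "k + j \<le> m" "k \<le> p"
  shows "(\<Sum>i\<le>n. pochhammer (- real n) i * pochhammer (c + real m) i * pochhammer (d + real p) i
            / (pochhammer a i * pochhammer b i * fact i)
          * (pochhammer a (k + i) * pochhammer (b + real j) (k + i)
              / (pochhammer (c + real j) (k + i) * pochhammer d (k + i)))) = 0"
proof -
  obtain q1 where q1: "degree q1 \<le> k" "\<And>x. poly q1 x = pochhammer (a + x) k"
    using pochhammer_shift_poly by blast
  obtain q2 where q2: "degree q2 \<le> k + j" "\<And>x. poly q2 x = pochhammer (b + x) (k + j)"
    using pochhammer_shift_poly by blast
  obtain q3 where q3: "degree q3 \<le> m - j - k"
      "\<And>x. poly q3 x = pochhammer (c + real j + real k + x) (m - j - k)"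
    using pochhammer_shift_poly by blast
  obtain q4 where q4: "degree q4 \<le> p - k" "\<And>x. poly q4 x = pochhammer (d + real k + x) (p - k)"
    using pochhammer_shift_poly by blast
  define q where "q = q1 * q2 * q3 * q4"
  have "degree q \<le> degree q1 + degree q2 + degree q3 + degree q4"
    unfolding q_def by (meson add_le_mono1 degree_mult_le le_trans)
  also have "\<dots> < n" using q1(1) q2(1) q3(1) q4(1) n k by linarith
  finally have "degree q < n" .
  define K where "K = pochhammer c j / (pochhammer c m * pochhammer d p * pochhammer b j)"
  have ne: "pochhammer z i \<noteq> 0" if "z > 0" for z :: real and i
    using pochhammer_pos[OF that, of i] by simp
  have bin: "pochhammer (- real n) i / fact i = (-1) ^ i * real (n choose i)" for i
    by (simp add: binomial_gbinomial gbinomial_pochhammer)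
  have "pochhammer (- real n) i * pochhammer (c + real m) i * pochhammer (d + real p) i
            / (pochhammer a i * pochhammer b i * fact i)
          * (pochhammer a (k + i) * pochhammer (b + real j) (k + i)
              / (pochhammer (c + real j) (k + i) * pochhammer d (k + i)))
        = K * ((-1) ^ i * real (n choose i) * poly q (real i))" for i
  proof -
    have A: "pochhammer a (k + i) = pochhammer a i * poly q1 (real i)"
      unfolding q1 by (metis add.commute pochhammer_product')
    have B: "pochhammer b j * pochhammer (b + real j) (k + i) = pochhammer b i * poly q2 (real i)"
      unfolding q2 using pochhammer_product'[of b j "k + i"] pochhammer_product'[of b i "k + j"]
      by (simp add: ac_simps)
    \<comment> \<open>The product \<open>(c)_(m+i)\<close> is cut in two ways: at \<open>j\<close>
      and \<open>j+k+i\<close> here, which relies on \<open>k + j \<le> m\<close>, and at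
      \<open>m\<close> in \<open>C\<close>. The parameter \<open>d\<close> is handled alike, with
      \<open>k \<le> p\<close>.\<close>
    have "pochhammer c j * pochhammer (c + real j) (k + i) * poly q3 (real i) = pochhammer c (m + i)"
      unfolding q3 using pochhammer_product'[of c j "k + i"]
        pochhammer_product'[of c "j + (k + i)" "m - j - k"] k
      by (simp add: ac_simps)
    then have C: "pochhammer c j * pochhammer (c + real j) (k + i) * poly q3 (real i)
        = pochhammer c m * pochhammer (c + real m) i"
      by (simp add: pochhammer_product')
    have "pochhammer d (k + i) * poly q4 (real i) = pochhammer d (p + i)"
      unfolding q4 using pochhammer_product'[of d "k + i" "p - k"] k by (simp add: ac_simps)
    then have D: "pochhammer d (k + i) * poly q4 (real i) = pochhammer d p * pochhammer (d + real p) i"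
      by (simp add: pochhammer_product')
    have C': "pochhammer (c + real m) i / pochhammer (c + real j) (k + i)
        = pochhammer c j / pochhammer c m * poly q3 (real i)"
      using C ne[of c m] ne[of "c + real j" "k + i"] pos by (simp add: field_simps)
    have D': "pochhammer (d + real p) i / pochhammer d (k + i) = poly q4 (real i) / pochhammer d p"
      using D ne[of d p] ne[of d "k + i"] pos by (simp add: field_simps)
    have B': "pochhammer (b + real j) (k + i) / pochhammer b i = poly q2 (real i) / pochhammer b j"
      using B ne[of b j] ne[of b i] pos by (simp add: field_simps)
    have A': "pochhammer a (k + i) / pochhammer a i = poly q1 (real i)"
      using A ne[of a i] pos by (simp add: field_simps)
    have "pochhammer (- real n) i * pochhammer (c + real m) i * pochhammer (d + real p) i
            / (pochhammer a i * pochhammer b i * fact i)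
          * (pochhammer a (k + i) * pochhammer (b + real j) (k + i)
              / (pochhammer (c + real j) (k + i) * pochhammer d (k + i)))
       = (pochhammer (- real n) i / fact i) * (pochhammer a (k + i) / pochhammer a i)
         * (pochhammer (b + real j) (k + i) / pochhammer b i)
         * (pochhammer (c + real m) i / pochhammer (c + real j) (k + i))
         * (pochhammer (d + real p) i / pochhammer d (k + i))"
      by (simp add: mult_ac)
    also have "\<dots> = K * ((-1) ^ i * real (n choose i) * poly q (real i))"
      unfolding A' B' C' D' bin by (simp add: K_def q_def mult_ac)
    finally show ?thesis .
  qed
  then show ?thesis
    using alternating_binomial_sum_poly_eq_0[of q n] \<open>degree q < n\<close>
    by (simp flip: sum_distrib_left)
qed

section \<open>Gauss's series at 1: convergence and a contiguous relation\<close>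

text \<open>The coefficient of \<open>z^n\<close> in \<open>2F1(A, B; C; z)\<close>, hence also the
  \<open>n\<close>-th term of Gauss's series at \<open>z = 1\<close>.\<close>

definition gauss_term :: "real \<Rightarrow> real \<Rightarrow> real \<Rightarrow> nat \<Rightarrow> real" where
  "gauss_term A B C n = pochhammer A n * pochhammer B n / (pochhammer C n * fact n)"

text \<open>Each Pochhammer symbol is replaced by Euler's sequence \<open>rGamma_series\<close>,
  which converges to the reciprocal Gamma function.\<close>

lemma gauss_term_asymptotics:
  assumes "C > 0"
  shows "(\<lambda>n. gauss_term A B C n / real n powr (A + B - C - 1)) \<longlonglongrightarrow> rGamma A * rGamma B / rGamma C"
proof -
  have "rGamma C \<noteq> 0" using assms by (auto simp: rGamma_eq_zero_iff elim!: nonpos_Ints_cases')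
  \<comment> \<open>\<open>rGamma_series z n\<close> contains the Pochhammer symbol of order
    \<open>n + 1\<close>; this rational factor removes the surplus factors
    \<open>z + n\<close>.\<close>
  have "(\<lambda>n. real n * (C + real n) / ((A + real n) * (B + real n))) \<longlonglongrightarrow> 1"
    by real_asymp
  then have "(\<lambda>n. rGamma_series A n * rGamma_series B n / rGamma_series C n
      * (real n * (C + real n) / ((A + real n) * (B + real n)))) \<longlonglongrightarrow> rGamma A * rGamma B / rGamma C * 1"
    using \<open>rGamma C \<noteq> 0\<close> by (intro tendsto_intros)
  moreover have "eventually (\<lambda>n. A + real n > 0 \<and> B + real n > 0 \<and> n > 0) sequentially"
    by (intro eventually_conj; real_asymp)
  then have "eventually (\<lambda>n. rGamma_series A n * rGamma_series B n / rGamma_series C n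
      * (real n * (C + real n) / ((A + real n) * (B + real n)))
      = gauss_term A B C n / real n powr (A + B - C - 1)) sequentially"
  proof eventually_elim
    case (elim n)
    have P: "pochhammer z n = rGamma_series z n * fact n * real n powr z / (z + real n)"
      if "z + real n > 0" for z
      using that elim by (simp add: rGamma_series_def pochhammer_Suc powr_def)
    have C: "rGamma_series C n \<noteq> 0"
      using pochhammer_pos[OF assms, of "Suc n"] by (simp add: rGamma_series_def)
    have pow: "real n powr (A + B - C - 1) = real n powr A * real n powr B / real n powr C / real n"
      using elim by (simp add: powr_diff powr_add)
    define F :: real where "F = fact n"
    have "F \<noteq> 0" by (simp add: F_def)
    have "C + real n > 0" using assms by simp
    show ?case
      using elim C \<open>F \<noteq> 0\<close> \<open>C + real n > 0\<close>
      unfolding gauss_term_def pow P[OF conjunct1[OF elim]]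
        P[OF conjunct1[OF conjunct2[OF elim]]] P[OF \<open>C + real n > 0\<close>] F_def[symmetric]
      by (simp add: divide_simps)
  qed
  ultimately show ?thesis by (simp add: Lim_transform_eventually)
qed

lemma summable_gauss_term:
  assumes "C > 0" "C - A - B > 0"
  shows "summable (\<lambda>n. \<bar>gauss_term A B C n\<bar>)"
proof -
  have "gauss_term A B C \<in> O(\<lambda>n. real n powr (A + B - C - 1))"
    by (rule bigoI_tendsto[OF gauss_term_asymptotics])
      (use assms in \<open>auto intro: eventually_mono[OF eventually_gt_at_top[of 0]]\<close>)
  then have "(\<lambda>n. \<bar>gauss_term A B C n\<bar>) \<in> O(\<lambda>n. real n powr (A + B - C - 1))"
    by simp
  then show ?thesis
    by (rule summable_comparison_test_bigo[rotated])
      (use assms in \<open>simp add: summable_real_powr_iff\<close>)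
qed

text \<open>Makes the boundary term at infinity vanish when \<open>gauss_term_telescope\<close> is
  summed.\<close>

lemma n_times_gauss_term_tendsto_0:
  assumes "C > 0" "C - A - B > 0"
  shows "(\<lambda>n. real n * gauss_term A B C n) \<longlonglongrightarrow> 0"
proof -
  have "(\<lambda>n. real n powr (A + B - C)) \<longlonglongrightarrow> 0"
    using assms by real_asymp
  then have "(\<lambda>n. gauss_term A B C n / real n powr (A + B - C - 1) * real n powr (A + B - C))
      \<longlonglongrightarrow> rGamma A * rGamma B / rGamma C * 0"
    using assms by (intro tendsto_mult gauss_term_asymptotics)
  moreover have "eventually (\<lambda>n. gauss_term A B C n / real n powr (A + B - C - 1) * real n powr (A + B - C)
      = real n * gauss_term A B C n) sequentially"
    using eventually_gt_at_top[of 0]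
    by eventually_elim (simp add: powr_diff powr_add)
  ultimately show ?thesis by (simp add: Lim_transform_eventually)
qed

text \<open>Every term is a rational multiple of \<open>gauss_term A B C n\<close> with denominator
  at most \<open>C + n\<close>, so a polynomial identity remains. It is the telescoping certificate
  for the contiguous relation in \<open>C\<close>.\<close>

lemma gauss_term_telescope:
  assumes "C > 0"
  shows "C * (C - A - B) * gauss_term A B C n - (C - A) * (C - B) * gauss_term A B (C + 1) n
    = C * (real n * gauss_term A B C n) - C * (real (Suc n) * gauss_term A B C (Suc n))"
proof -
  have n: "C + real n > 0" using assms by simp
  have "gauss_term A B (C + 1) n = gauss_term A B C n * (C / (C + real n))"
  proof -
    have "C * pochhammer (C + 1) n = pochhammer C n * (C + real n)"
      by (metis pochhammer_rec pochhammer_Suc)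
    then show ?thesis
      using assms n pochhammer_pos[of C n] pochhammer_pos[of "C + 1" n]
      by (simp add: gauss_term_def divide_simps)
  qed
  moreover have "real (Suc n) * gauss_term A B C (Suc n)
      = gauss_term A B C n * ((A + real n) * (B + real n) / (C + real n))"
    using n pochhammer_pos[OF assms, of n]
    by (simp add: gauss_term_def pochhammer_Suc divide_simps del: of_nat_Suc)
  moreover have "C * (C - A - B) * t - (C - A) * (C - B) * (t * (C / (C + r)))
      = C * (r * t) - C * (t * ((A + r) * (B + r) / (C + r)))" if "C + r \<noteq> 0" for t r
  proof -
    \<comment> \<open>Measuring everything in units of \<open>s\<close> clears the
      denominator.\<close>
    define s where "s = t / (C + r)"
    have t: "t = s * (C + r)" using that by (simp add: s_def)
    have "t * (C / (C + r)) = s * C" "t * ((A + r) * (B + r) / (C + r)) = s * ((A + r) * (B + r))"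
      by (simp_all add: s_def)
    then show ?thesis unfolding t by algebra
  qed
  ultimately show ?thesis
    using n by simp
qed

lemma suminf_gauss_term_contiguous:
  assumes "C > 0" "C - A - B > 0"
  shows "C * (C - A - B) * (\<Sum>n. gauss_term A B C n)
    = (C - A) * (C - B) * (\<Sum>n. gauss_term A B (C + 1) n)"
proof -
  have s: "summable (gauss_term A B C)" "summable (gauss_term A B (C + 1))"
    using summable_gauss_term[of C A B] summable_gauss_term[of "C + 1" A B] assms
    by (auto intro: summable_rabs_cancel)
  have "(\<lambda>n. C * (real n * gauss_term A B C n)) \<longlonglongrightarrow> C * 0"
    using assms by (intro tendsto_intros n_times_gauss_term_tendsto_0)
  \<comment> \<open>The telescoped sum is 0: the term at \<open>n = 0\<close> carries the factor
    \<open>n\<close>, and the limit is 0.\<close>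
  from telescope_sums'[OF this]
  have "(\<lambda>n. C * (C - A - B) * gauss_term A B C n - (C - A) * (C - B) * gauss_term A B (C + 1) n) sums 0"
    using assms(1) by (simp only: gauss_term_telescope) simp
  moreover have "(\<lambda>n. C * (C - A - B) * gauss_term A B C n - (C - A) * (C - B) * gauss_term A B (C + 1) n)
    sums (C * (C - A - B) * (\<Sum>n. gauss_term A B C n) - (C - A) * (C - B) * (\<Sum>n. gauss_term A B (C + 1) n))"
    using s by (intro sums_diff sums_mult summable_sums)
  ultimately show ?thesis using sums_unique2 by fastforce
qed

section \<open>Termwise integration and the moments of \<open>W\<close>\<close>

lemma summable_gauss_term_power:
  assumes "C > 0" "\<bar>y\<bar> < 1"
  shows "summable (\<lambda>n. \<bar>gauss_term A B C n * y ^ n\<bar>)"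
proof -
  \<comment> \<open>The term ratios tend to \<open>\<bar>y\<bar>\<close> in absolute value;
    \<open>c\<close> is the midpoint between that limit and 1.\<close>
  define c where "c = (1 + \<bar>y\<bar>) / 2"
  have "(\<lambda>n. \<bar>(A + real n) * (B + real n) / ((C + real n) * (1 + real n))\<bar> * \<bar>y\<bar>) \<longlonglongrightarrow> \<bar>1\<bar> * \<bar>y\<bar>"
    by (intro tendsto_mult tendsto_const tendsto_rabs) real_asymp
  then have "eventually (\<lambda>n. \<bar>(A + real n) * (B + real n) / ((C + real n) * (1 + real n))\<bar> * \<bar>y\<bar> < c) sequentially"
    by (rule order_tendstoD) (use assms in \<open>simp add: c_def\<close>)
  then obtain N where N: "\<And>n. n \<ge> N \<Longrightarrow>
      \<bar>(A + real n) * (B + real n) / ((C + real n) * (1 + real n))\<bar> * \<bar>y\<bar> < c"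
    by (auto simp: eventually_sequentially)
  show ?thesis
  proof (rule summable_ratio_test)
    show "c < 1" using assms by (simp add: c_def)
    fix n assume n: "n \<ge> N"
    have "gauss_term A B C (Suc n) * y ^ Suc n
        = (A + real n) * (B + real n) / ((C + real n) * (1 + real n)) * y * (gauss_term A B C n * y ^ n)"
      by (simp add: gauss_term_def pochhammer_Suc mult_ac)
    then have "\<bar>gauss_term A B C (Suc n) * y ^ Suc n\<bar>
        = \<bar>(A + real n) * (B + real n) / ((C + real n) * (1 + real n))\<bar> * \<bar>y\<bar> * \<bar>gauss_term A B C n * y ^ n\<bar>"
      by (simp only: abs_mult)
    also have "\<dots> \<le> c * \<bar>gauss_term A B C n * y ^ n\<bar>"
      using N[OF n] by (intro mult_right_mono) auto
    finally show "norm \<bar>gauss_term A B C (Suc n) * y ^ Suc n\<bar> \<le> c * norm \<bar>gauss_term A B C n * y ^ n\<bar>"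
      by simp
  qed
qed

lemma W_eq_suminf:
  fixes a b c d :: real
  defines "\<delta> \<equiv> c + d - a - b"
  shows "W a b c d x = Gamma c * Gamma d / (Gamma a * Gamma b * Gamma \<delta>)
    * x powr (a - 1) * (1 - x) powr (\<delta> - 1) * (\<Sum>n. gauss_term (c - b) (d - b) \<delta> n * (1 - x) ^ n)"
  by (simp add: W_def Let_def hypergeo_def gauss_term_def \<delta>_def)

lemma Beta_indicator:
  fixes a b :: real
  assumes "a > 0" "b > 0"
  shows "integrable lborel (\<lambda>x. indicator {0<..<1} x * (x powr (a - 1) * (1 - x) powr (b - 1)))"
    and "(\<integral>x. indicator {0<..<1} x * (x powr (a - 1) * (1 - x) powr (b - 1)) \<partial>lborel) = Beta a b"
proof -
  \<comment> \<open>Open and closed interval give the same function even at the endpoints, because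
    \<open>0 powr y = 0\<close> for every \<open>y\<close>.\<close>
  have eq: "(\<lambda>x. indicator {0<..<1} x * (x powr (a - 1) * (1 - x) powr (b - 1)))
      = (\<lambda>x. indicat_real {0..1} x *\<^sub>R (x powr (a - 1) * (1 - x) powr (b - 1)))"
    by (auto simp: indicator_def fun_eq_iff)
  show "integrable lborel (\<lambda>x. indicator {0<..<1} x * (x powr (a - 1) * (1 - x) powr (b - 1)))"
    unfolding eq using integrable_Beta[OF assms] by (simp only: set_integrable_def)
  show "(\<integral>x. indicator {0<..<1} x * (x powr (a - 1) * (1 - x) powr (b - 1)) \<partial>lborel) = Beta a b"
    unfolding eq
    using set_borel_integral_eq_integral(2)[OF integrable_Beta[OF assms]]
      has_integral_Beta_real[OF assms]
    by (simp add: set_lebesgue_integral_def integral_unique)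
qed

text \<open>\<open>Gamma (v + n) = Gamma v * (v)_n\<close> cancels the lower Pochhammer symbol, and
  \<open>Gamma (u + v + n)\<close> supplies a new one. Integration thus raises the lower parameter
  from \<open>v\<close> to \<open>u + v\<close>.\<close>

lemma gauss_term_times_Beta:
  assumes "u > 0" "v > 0"
  shows "gauss_term A B v n * Beta u (v + real n)
    = Gamma u * Gamma v / Gamma (u + v) * gauss_term A B (u + v) n"
proof -
  have P: "Gamma (z + real n) = Gamma z * pochhammer z n" if "z > 0" for z
    using that by (subst pochhammer_Gamma) (auto simp: Gamma_eq_zero_iff elim!: nonpos_Ints_cases')
  have "Gamma (u + v + real n) = Gamma (u + v) * pochhammer (u + v) n"
    using P[of "u + v"] assms by simp
  then show ?thesis
    using P[of v] assms pochhammer_pos[of v n]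
    by (simp add: gauss_term_def Beta_def add.assoc mult_ac)
qed

text \<open>Sum and integral may be exchanged because the integrals of the norms form, up to a
  constant, an absolutely convergent Gauss series.\<close>

lemma W_moment:
  fixes a b c d :: real
  assumes pos: "a > 0" "b > 0" and \<delta>: "c + d - a - b > 0"
  shows "set_integrable lborel {0<..<1} (\<lambda>x. x ^ k * W a b c d x)"
    and "(LBINT x:{0<..<1}. x ^ k * W a b c d x)
      = Gamma c * Gamma d / (Gamma a * Gamma b) * Gamma (a + real k) / Gamma (c + d - b + real k)
        * (\<Sum>n. gauss_term (c - b) (d - b) (c + d - b + real k) n)"
proof -
  define \<delta> where "\<delta> = c + d - a - b"
  define K where "K = Gamma c * Gamma d / (Gamma a * Gamma b * Gamma \<delta>)"
  define t where "t = gauss_term (c - b) (d - b) \<delta>"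
  define C where "C = c + d - b + real k"
  define g where "g n x = indicator {0<..<1} x * (x powr (a + real k - 1) * (1 - x) powr (\<delta> + real n - 1))"
    for n and x :: real
  define f where "f n x = K * t n * g n x" for n x
  have "\<delta> > 0" using \<delta> by (simp add: \<delta>_def)
  then have "Gamma \<delta> > 0" by (rule Gamma_real_pos)
  \<comment> \<open>The second quantity equals \<open>b + k\<close>; its positivity is the
    convergence condition at argument 1.\<close>
  have C: "C > 0" "C - (c - b) - (d - b) > 0" "a + real k + \<delta> = C"
    using pos \<delta> by (auto simp: C_def \<delta>_def)
  have ak: "a + real k > 0" using pos by simp
  have dn: "\<delta> + real n > 0" for n using \<open>\<delta> > 0\<close> by simp
  have int_g: "integrable lborel (g n)" "integral\<^sup>L lborel (g n) = Beta (a + real k) (\<delta> + real n)" for n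
    using Beta_indicator[OF ak dn[of n]] unfolding g_def by simp_all
  have g_nonneg: "g n x \<ge> 0" for n x by (auto simp: g_def indicator_def)
  have f_expand: "f n x = indicator {0<..<1} x * (x ^ k * (K * x powr (a - 1) * (1 - x) powr (\<delta> - 1)))
      * (t n * (1 - x) ^ n)" for n x
  proof (cases "x \<in> {0<..<1}")
    case True
    then have "x powr (a + real k - 1) = x powr (a - 1) * x ^ k"
      and "(1 - x) powr (\<delta> + real n - 1) = (1 - x) powr (\<delta> - 1) * (1 - x) ^ n"
      by (simp_all add: powr_diff powr_add powr_realpow)
    then show ?thesis by (simp add: f_def g_def)
  qed (simp add: f_def g_def)
  have summ: "summable (\<lambda>n. norm (f n x))" for x
  proof (cases "x \<in> {0<..<1}")
    case True
    then have "summable (\<lambda>n. \<bar>t n * (1 - x) ^ n\<bar>)"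
      unfolding t_def by (intro summable_gauss_term_power \<open>\<delta> > 0\<close>) auto
    then show ?thesis unfolding f_expand real_norm_def abs_mult[of "_ * _" "_ * _"]
      by (rule summable_mult)
  qed (simp add: f_def g_def)
  have f_suminf: "(\<Sum>n. f n x) = indicat_real {0<..<1} x *\<^sub>R (x ^ k * W a b c d x)" for x
  proof (cases "x \<in> {0<..<1}")
    case True
    then have "summable (\<lambda>n. t n * (1 - x) ^ n)"
      unfolding t_def
      by (intro summable_rabs_cancel[OF summable_gauss_term_power] \<open>\<delta> > 0\<close>) auto
    then show ?thesis
      unfolding f_expand W_eq_suminf by (subst suminf_mult) (simp_all add: K_def t_def \<delta>_def)
  qed (simp add: f_def g_def)
  have Gauss: "t n * Beta (a + real k) (\<delta> + real n)
      = Gamma (a + real k) * Gamma \<delta> / Gamma C * gauss_term (c - b) (d - b) C n" for n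
    unfolding t_def using gauss_term_times_Beta[OF ak \<open>\<delta> > 0\<close>] C(3) by simp
  have int_f: "integrable lborel (f n)" for n
    unfolding f_def by (intro integrable_mult_right int_g)
  have int_norm: "(\<integral>x. norm (f n x) \<partial>lborel)
      = \<bar>K * (Gamma (a + real k) * Gamma \<delta> / Gamma C)\<bar> * \<bar>gauss_term (c - b) (d - b) C n\<bar>" for n
  proof -
    have B: "Beta (a + real k) (\<delta> + real n) \<ge> 0"
      unfolding int_g(2)[symmetric] by (intro integral_nonneg_AE AE_I2 g_nonneg)
    have "(\<integral>x. norm (f n x) \<partial>lborel) = (\<integral>x. \<bar>K * t n\<bar> * g n x \<partial>lborel)"
      by (intro Bochner_Integration.integral_cong) (auto simp: f_def abs_mult g_nonneg)
    also have "\<dots> = \<bar>K * t n\<bar> * Beta (a + real k) (\<delta> + real n)"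
      by (simp add: int_g)
    also have "\<dots> = \<bar>K * (t n * Beta (a + real k) (\<delta> + real n))\<bar>"
      using B by (simp add: abs_mult)
    finally show ?thesis unfolding Gauss by (simp add: abs_mult)
  qed
  have summ_int: "summable (\<lambda>n. \<integral>x. norm (f n x) \<partial>lborel)"
    unfolding int_norm by (intro summable_mult summable_gauss_term C)
  have AE_summ: "AE x in lborel. summable (\<lambda>n. norm (f n x))"
    using summ by simp
  show "set_integrable lborel {0<..<1} (\<lambda>x. x ^ k * W a b c d x)"
    using integrable_suminf[OF int_f AE_summ summ_int]
    by (simp only: f_suminf set_integrable_def)
  have sm: "summable (gauss_term (c - b) (d - b) C)"
    using summable_gauss_term[OF C(1,2)] by (rule summable_rabs_cancel)
  have "(LBINT x:{0<..<1}. x ^ k * W a b c d x) = (\<Sum>n. integral\<^sup>L lborel (f n))"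
    using integral_suminf[OF int_f AE_summ summ_int]
    by (simp only: f_suminf set_lebesgue_integral_def)
  also have "\<dots> = (\<Sum>n. K * (Gamma (a + real k) * Gamma \<delta> / Gamma C) * gauss_term (c - b) (d - b) C n)"
  proof -
    have "integral\<^sup>L lborel (f n) = K * (t n * Beta (a + real k) (\<delta> + real n))" for n
      unfolding f_def by (simp add: int_g)
    then show ?thesis by (simp add: Gauss mult.assoc)
  qed
  also have "\<dots> = K * (Gamma (a + real k) * Gamma \<delta> / Gamma C) * (\<Sum>n. gauss_term (c - b) (d - b) C n)"
    by (rule suminf_mult[OF sm])
  finally show "(LBINT x:{0<..<1}. x ^ k * W a b c d x)
      = Gamma c * Gamma d / (Gamma a * Gamma b) * Gamma (a + real k) / Gamma (c + d - b + real k)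
        * (\<Sum>n. gauss_term (c - b) (d - b) (c + d - b + real k) n)"
    using \<open>Gamma \<delta> > 0\<close> by (simp add: K_def C_def)
qed

text \<open>The Gamma factors contribute \<open>(a + k) / C\<close> and the contiguous relation
  contributes \<open>C (b + k) / ((c + k) (d + k))\<close>, so \<open>C\<close> cancels.\<close>

lemma W_moment_recurrence:
  fixes a b c d :: real
  assumes pos: "a > 0" "b > 0" "c > 0" "d > 0" and \<delta>: "c + d - a - b > 0"
  shows "(LBINT x:{0<..<1}. x ^ Suc k * W a b c d x)
    = (a + real k) * (b + real k) / ((c + real k) * (d + real k)) * (LBINT x:{0<..<1}. x ^ k * W a b c d x)"
proof -
  define C where "C = c + d - b + real k"
  define F where "F = (\<Sum>n. gauss_term (c - b) (d - b) C n)"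
  define F1 where "F1 = (\<Sum>n. gauss_term (c - b) (d - b) (C + 1) n)"
  have "C > 0" using pos \<delta> by (simp add: C_def)
  moreover have "C - (c - b) - (d - b) = b + real k" "C - (c - b) = d + real k" "C - (d - b) = c + real k"
    by (simp_all add: C_def)
  ultimately have "C * (b + real k) * F = (d + real k) * (c + real k) * F1"
    using suminf_gauss_term_contiguous[of C "c - b" "d - b"] pos by (simp only: F_def F1_def)
  then have F1: "F1 = C * (b + real k) / ((c + real k) * (d + real k)) * F"
    using pos by (simp add: nonzero_eq_divide_eq mult_ac)
  have "a + real k \<notin> \<int>\<^sub>\<le>\<^sub>0" "C \<notin> \<int>\<^sub>\<le>\<^sub>0"
    using pos \<open>C > 0\<close> by (auto dest: nonpos_Ints_nonpos)
  then have G: "Gamma (a + real (Suc k)) = (a + real k) * Gamma (a + real k)"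
      "Gamma (C + 1) = C * Gamma C"
    using Gamma_plus1[of "a + real k"] Gamma_plus1[of C] by (simp_all add: add_ac)
  have "Gamma C > 0" using \<open>C > 0\<close> by (rule Gamma_real_pos)
  have C1: "c + d - b + real (Suc k) = C + 1" by (simp add: C_def)
  show ?thesis
    unfolding W_moment(2)[OF pos(1,2) \<delta>] C1 C_def[symmetric] F_def[symmetric] F1_def[symmetric] G F1
    using \<open>C > 0\<close> \<open>Gamma C > 0\<close> by (simp add: mult_ac)
qed

lemma W_moment_pochhammer:
  fixes a b c d :: real
  assumes pos: "a > 0" "b > 0" "c > 0" "d > 0" and \<delta>: "c + d - a - b > 0"
  shows "(LBINT x:{0<..<1}. x ^ k * W a b c d x)
    = pochhammer a k * pochhammer b k / (pochhammer c k * pochhammer d k) * (LBINT x:{0<..<1}. W a b c d x)"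
proof (induction k)
  case (Suc k)
  show ?case
    unfolding W_moment_recurrence[OF assms] Suc by (simp add: pochhammer_Suc mult_ac)
qed simp

section \<open>Weighted integrals of polynomials and uniqueness of the orthogonal sequence\<close>

lemma
  fixes w :: "real \<Rightarrow> real"
  assumes "\<And>k. set_integrable lborel S (\<lambda>x. x ^ k * w x)"
  shows set_integrable_poly_times: "set_integrable lborel S (\<lambda>x. x ^ k * poly p x * w x)"
    and set_integral_poly_times: "degree p \<le> n \<Longrightarrow> (LBINT x:S. x ^ k * poly p x * w x)
      = (\<Sum>i\<le>n. coeff p i * (LBINT x:S. x ^ (k + i) * w x))"
proof -
  have eq: "x ^ k * poly p x * w x = (\<Sum>i\<le>n. coeff p i * (x ^ (k + i) * w x))"
    if "degree p \<le> n" for n x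
  proof -
    have "poly p x = (\<Sum>i\<le>n. coeff p i * x ^ i)"
      unfolding poly_altdef using that by (intro sum.mono_neutral_left) (auto simp: coeff_eq_0)
    then show ?thesis by (simp add: sum_distrib_left sum_distrib_right power_add mult_ac)
  qed
  have int: "integrable lborel (\<lambda>x. indicat_real S x * (coeff p i * (x ^ (k + i) * w x)))" for i
    using integrable_mult_right[OF assms[unfolded set_integrable_def], of "coeff p i" "k + i"]
    by (simp add: mult_ac)
  show "set_integrable lborel S (\<lambda>x. x ^ k * poly p x * w x)"
    unfolding set_integrable_def eq[OF order_refl] real_scaleR_def sum_distrib_left
    by (intro Bochner_Integration.integrable_sum int)
  assume n: "degree p \<le> n"
  have "(LBINT x:S. x ^ k * poly p x * w x)
      = (\<Sum>i\<le>n. \<integral>x. indicat_real S x * (coeff p i * (x ^ (k + i) * w x)) \<partial>lborel)"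
    unfolding set_lebesgue_integral_def eq[OF n] real_scaleR_def sum_distrib_left
    by (intro Bochner_Integration.integral_sum int)
  also have "\<dots> = (\<Sum>i\<le>n. coeff p i * (LBINT x:S. x ^ (k + i) * w x))"
    by (simp add: set_lebesgue_integral_def mult.left_commute[of "indicat_real S _"])
  finally show "(LBINT x:S. x ^ k * poly p x * w x)
      = (\<Sum>i\<le>n. coeff p i * (LBINT x:S. x ^ (k + i) * w x))" .
qed

text \<open>Subtracting the multiple of \<open>P n\<close> that kills the top coefficient keeps the
  conditions for \<open>i < n\<close>, so by induction \<open>R\<close> is a multiple of
  \<open>P n\<close>; the functional \<open>L n\<close> then forces the factor to be 0.\<close>

lemma biorthogonal_poly_eq_0:
  fixes L :: "nat \<Rightarrow> 'a :: field poly \<Rightarrow> 'a"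
  assumes L_diff: "\<And>i p q. L i (p - q) = L i p - L i q"
    and L_smult: "\<And>i r p. L i (smult r p) = r * L i p"
    and P: "\<And>n. degree (P n) = n" "\<And>n. lead_coeff (P n) = 1"
    and L_0: "\<And>i n. i < n \<Longrightarrow> L i (P n) = 0" and L_diag: "\<And>i. L i (P i) \<noteq> 0"
    and R: "R = 0 \<or> degree R < n" "\<And>i. i < n \<Longrightarrow> L i R = 0"
  shows "R = 0"
  using R
proof (induction n arbitrary: R)
  case (Suc n)
  define r where "r = coeff R n"
  define R' where "R' = R - smult r (P n)"
  have "R' = 0"
  proof (rule Suc.IH)
    have "coeff R' n = 0" using P(1)[of n] P(2)[of n] by (simp add: R'_def r_def)
    moreover have "degree R' \<le> n"
      unfolding R'_def using Suc.prems(1) P(1)[of n]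
      by (intro degree_diff_le) (auto intro: order.trans[OF degree_smult_le])
    ultimately show "R' = 0 \<or> degree R' < n"
      by (metis eq_zero_or_degree_less)
    show "L i R' = 0" if "i < n" for i
      using that Suc.prems(2)[of i] L_0[of i n] by (simp add: R'_def L_diff L_smult)
  qed
  then have "R = smult r (P n)" by (simp add: R'_def)
  moreover from this have "r * L n (P n) = 0"
    using Suc.prems(2)[of n] by (simp add: L_smult)
  ultimately show ?case using L_diag[of n] by simp
qed simp

lemma hypergeo_3F2_terminating:
  "hypergeo [- real n, u, v] [a, b] x
    = (\<Sum>i\<le>n. pochhammer (- real n) i * pochhammer u i * pochhammer v i
        / (pochhammer a i * pochhammer b i * fact i) * x ^ i)"
proof -
  have "hypergeo [- real n, u, v] [a, b] x
      = (\<Sum>i. pochhammer (- real n) i * pochhammer u i * pochhammer v i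
        / (pochhammer a i * pochhammer b i * fact i) * x ^ i)"
    by (simp add: hypergeo_def mult.assoc)
  also have "\<dots> = (\<Sum>i\<le>n. pochhammer (- real n) i * pochhammer u i * pochhammer v i
        / (pochhammer a i * pochhammer b i * fact i) * x ^ i)"
    by (rule suminf_finite) (auto simp: pochhammer_of_nat_eq_0_iff)
  finally show ?thesis .
qed

text \<open>Both components are the same weight with \<open>b\<close> and \<open>c\<close> shifted
  by \<open>j\<close>, which leaves \<open>c + d - a - b\<close> unchanged.\<close>

lemma W_vec_moments:
  fixes a b c d :: real
  assumes pos: "a > 0" "b > 0" "c > 0" "d > 0" and \<delta>: "c + d - a - b > 0" and j: "j \<in> {0, 1}"
  shows "set_integrable lborel {0<..<1} (\<lambda>x. x ^ k * W_vec a b c d j x)"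
    and "(LBINT x:{0<..<1}. x ^ k * W_vec a b c d j x)
      = (LBINT x:{0<..<1}. W_vec a b c d j x)
        * (pochhammer a k * pochhammer (b + real j) k / (pochhammer (c + real j) k * pochhammer d k))"
proof -
  have W: "W_vec a b c d j = W a (b + real j) (c + real j) d"
    using j by (auto simp: W_vec_def)
  have p: "b + real j > 0" "c + real j > 0" "(c + real j) + d - a - (b + real j) > 0"
    using pos \<delta> by simp_all
  show "set_integrable lborel {0<..<1} (\<lambda>x. x ^ k * W_vec a b c d j x)"
    unfolding W using pos p by (intro W_moment) auto
  show "(LBINT x:{0<..<1}. x ^ k * W_vec a b c d j x)
      = (LBINT x:{0<..<1}. W_vec a b c d j x)
        * (pochhammer a k * pochhammer (b + real j) k / (pochhammer (c + real j) k * pochhammer d k))"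
    unfolding W W_moment_pochhammer[OF pos(1) p(1,2) pos(4) p(3)] by simp
qed

text \<open>\<open>P n - Q\<close> has degree below \<open>n\<close> or is 0, and the first
  \<open>n\<close> functionals annihilate it. The nonzero diagonal comes from \<open>P\<close>, so
  \<open>Q\<close> has only vanishing conditions to satisfy.\<close>

lemma monic_2_orthogonal_unique:
  assumes int: "\<And>j k. j \<in> {0, 1} \<Longrightarrow> set_integrable lborel {0<..<1} (\<lambda>x. x ^ k * w j x)"
    and P: "monic_2_orthogonal w P"
    and Q: "degree Q = n" "lead_coeff Q = 1"
    and orth: "\<And>j k. j \<in> {0, 1} \<Longrightarrow> 2 * k + j < n \<Longrightarrow>
      (LBINT x:{0<..<1}. x ^ k * poly Q x * w j x) = 0"
  shows "P n = Q"
proof -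
  \<comment> \<open>The pairs \<open>(k, j)\<close> are enumerated by \<open>i = 2 k + j\<close>,
    hence \<open>k = i div 2\<close> and \<open>j = i mod 2\<close>.\<close>
  define L where "L i p = (LBINT x:{0<..<1}. x ^ (i div 2) * poly p x * w (i mod 2) x)" for i p
  have mod: "i mod 2 \<in> {0, 1}" for i :: nat by auto
  have deg: "degree (P n) = n" and lead: "lead_coeff (P n) = 1" for n
    using P unfolding monic_2_orthogonal_def by blast+
  have orth_P: "(LBINT x:{0<..<1}. x ^ k * poly (P n) x * w j x) = 0"
    if "j \<in> {0, 1}" "n \<ge> 2 * k + j + 1" for j k n
    using P that unfolding monic_2_orthogonal_def by blast
  have diag_P: "(LBINT x:{0<..<1}. x ^ k * poly (P (2 * k + j)) x * w j x) \<noteq> 0"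
    if "j \<in> {0, 1}" for j k
    using P that unfolding monic_2_orthogonal_def by blast
  have P_0: "L i (P n) = 0" if "i < n" for i n
    unfolding L_def using that by (intro orth_P mod) simp
  have P_diag: "L i (P i) \<noteq> 0" for i
    using diag_P[OF mod[of i], of "i div 2"] by (simp add: L_def)
  have L_diff: "L i (p - q) = L i p - L i q" for i p q
  proof -
    have "(\<lambda>x. x ^ (i div 2) * poly (p - q) x * w (i mod 2) x)
        = (\<lambda>x. x ^ (i div 2) * poly p x * w (i mod 2) x - x ^ (i div 2) * poly q x * w (i mod 2) x)"
      by (simp add: algebra_simps)
    then show ?thesis
      unfolding L_def
      using set_integral_diff(2)[OF set_integrable_poly_times[OF int[OF mod]]
          set_integrable_poly_times[OF int[OF mod]]]
      by simp
  qed
  have L_smult: "L i (smult r p) = r * L i p" for i r p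
  proof -
    have "(\<lambda>x. x ^ (i div 2) * poly (smult r p) x * w (i mod 2) x)
        = (\<lambda>x. r * (x ^ (i div 2) * poly p x * w (i mod 2) x))"
      by (simp add: mult_ac)
    then show ?thesis by (simp only: L_def set_integral_mult_right)
  qed
  have "P n - Q = 0"
  proof (rule biorthogonal_poly_eq_0[of L P])
    have "coeff (P n - Q) n = 0" using Q deg[of n] lead[of n] by simp
    moreover have "degree (P n - Q) \<le> n" using Q deg[of n] by (intro degree_diff_le) auto
    ultimately show "P n - Q = 0 \<or> degree (P n - Q) < n" by (metis eq_zero_or_degree_less)
    show "L i (P n - Q) = 0" if "i < n" for i
      using that P_0[of i n] orth[OF mod, of "i div 2" i] unfolding L_diff by (simp add: L_def)
  qed (fact L_diff L_smult deg lead P_0 P_diag)+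
  then show ?thesis by simp
qed

section \<open>Identification of the orthogonal polynomials with the \<open>3F2\<close>\<close>

theorem theorem3p1:
  fixes a b c d :: real and P :: "nat \<Rightarrow> real poly"
  assumes "a > 0" "b > 0" "c > 0" "d > 0"
    and "min c d > max a b"
    and "monic_2_orthogonal (W_vec a b c d) P"
  shows "\<forall>n x. poly (P n) x =
    (-1) ^ n * pochhammer a n * pochhammer b n
      / (pochhammer (c + of_int \<lfloor>real n / 2\<rfloor>) n * pochhammer (d + of_int \<lfloor>(real n - 1) / 2\<rfloor>) n)
    * hypergeo [- real n, c + of_int \<lfloor>real n / 2\<rfloor>, d + of_int \<lfloor>(real n - 1) / 2\<rfloor>] [a, b] x"
proof (intro allI)
  fix n :: nat and x :: real
  note pos = assms(1-4)
  have \<delta>: "c + d - a - b > 0" using assms(5) by simp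
  show "poly (P n) x =
    (-1) ^ n * pochhammer a n * pochhammer b n
      / (pochhammer (c + of_int \<lfloor>real n / 2\<rfloor>) n * pochhammer (d + of_int \<lfloor>(real n - 1) / 2\<rfloor>) n)
    * hypergeo [- real n, c + of_int \<lfloor>real n / 2\<rfloor>, d + of_int \<lfloor>(real n - 1) / 2\<rfloor>] [a, b] x"
  proof (cases n)
    \<comment> \<open>The second floor is \<open>-1\<close> here, so the splitting
      \<open>n = Suc (m + p)\<close> fails; both sides are simply 1.\<close>
    case 0
    have "degree (P 0) = 0" "lead_coeff (P 0) = 1"
      using assms(6) unfolding monic_2_orthogonal_def by blast+
    then have "poly (P 0) x = 1" by (simp add: poly_altdef)
    then show ?thesis unfolding 0 hypergeo_3F2_terminating by simp
  next
    case (Suc n')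
    define m p where "m = n div 2" and "p = n' div 2"
    have n: "n = Suc (m + p)" unfolding m_def p_def Suc by presburger
    have m: "\<lfloor>real n / 2\<rfloor> = int m"
      using floor_divide_of_nat_eq[of n 2, where 'a = real] by (simp add: m_def)
    have p: "\<lfloor>(real n - 1) / 2\<rfloor> = int p"
      using floor_divide_of_nat_eq[of n' 2, where 'a = real] by (simp add: p_def Suc)
    define t where "t i = pochhammer (- real n) i * pochhammer (c + real m) i * pochhammer (d + real p) i
        / (pochhammer a i * pochhammer b i * fact i)" for i
    define K where "K = (-1) ^ n * pochhammer a n * pochhammer b n
        / (pochhammer (c + real m) n * pochhammer (d + real p) n)"
    define Q where "Q = (\<Sum>i\<le>n. monom (K * t i) i)"
    have ne: "pochhammer z i > 0" if "z > 0" for z :: real and i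
      using pochhammer_pos[OF that] .
    have coeff_Q: "coeff Q i = (if i \<le> n then K * t i else 0)" for i
      by (simp add: Q_def coeff_sum)
    \<comment> \<open>Since \<open>(-n)_n = (-1)^n n!\<close>, the prefactor \<open>K\<close> is the
      reciprocal of the leading coefficient \<open>t n\<close>.\<close>
    have "K * t n = 1"
      using ne[of a n] ne[of b n] ne[of "c + real m" n] ne[of "d + real p" n] pos
      unfolding K_def t_def pochhammer_same by simp
    then have deg_Q: "degree Q = n"
      by (intro antisym degree_le le_degree) (auto simp: coeff_Q)
    have lead_Q: "lead_coeff Q = 1" unfolding deg_Q coeff_Q using \<open>K * t n = 1\<close> by simp
    have orth: "(LBINT x:{0<..<1}. x ^ k * poly Q x * W_vec a b c d j x) = 0"
      if j: "j \<in> {0, 1}" and k: "2 * k + j < n" for j k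
    proof -
      \<comment> \<open>The floors in the parameters are matched to the orthogonality range:
        \<open>2 k + j < n\<close> with \<open>j \<le> 1\<close> yields both bounds.\<close>
      have "k + j \<le> m" "k \<le> p" using j k unfolding m_def p_def Suc by auto
      note W = W_vec_moments[OF pos \<delta> j]
      have "(LBINT x:{0<..<1}. x ^ k * poly Q x * W_vec a b c d j x)
          = (\<Sum>i\<le>n. K * (LBINT x:{0<..<1}. W_vec a b c d j x) * (t i
              * (pochhammer a (k + i) * pochhammer (b + real j) (k + i)
              / (pochhammer (c + real j) (k + i) * pochhammer d (k + i)))))"
        unfolding set_integral_poly_times[OF W(1) eq_refl[OF deg_Q]] W(2)[of "k + _"]
        by (intro sum.cong) (simp_all add: coeff_Q)
      also have "\<dots> = 0"
        \<comment> \<open>The total mass of the weight is a common factor and is pulled out together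
          with \<open>K\<close>.\<close>
        unfolding sum_distrib_left[symmetric] t_def
        using hypergeometric_moment_sum_eq_0[OF pos n \<open>k + j \<le> m\<close> \<open>k \<le> p\<close>] by simp
      finally show ?thesis .
    qed
    have "P n = Q"
      using W_vec_moments(1)[OF pos \<delta>] assms(6) deg_Q lead_Q orth by (rule monic_2_orthogonal_unique)
    then have "poly (P n) x = K * (\<Sum>i\<le>n. t i * x ^ i)"
      by (simp add: Q_def poly_sum poly_monom sum_distrib_left mult.assoc)
    then show ?thesis
      unfolding m p hypergeo_3F2_terminating of_int_of_nat_eq K_def t_def .
  qed
qed

end
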